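(* Let $\mathbf{B}$ be a countable structure with carrier $B$ such that $\operatorname{End}(\mathbf{B})$ has only finitely many weak orbits on $B$, and let $h\colon \operatorname{End}(\mathbb{Q},\le)\to\operatorname{End}(\mathbf{B})$ be a monoid-isomorphism. Then $h$ is a homeomorphism.
   Context: A structure means a relational structure: a set $B$ (the carrier) with a family of finitary relations on $B$ indexed by an arbitrary relational signature. $\operatorname{End}(\mathbf{B})$ is the monoid, under composition, of all endomorphisms of $\mathbf{B}$, i.e. of all maps $B\to B$ preserving every basic relation. In particular $\operatorname{End}(\mathbb{Q},\le)$ is the monoid of all non-decreasing maps $\mathbb{Q}\to\mathbb{Q}$. For a set $B$, let $\mathfrak{T}_B$ be the monoid of all maps $B\to B$. It carries the topology of pointwise convergence (the product topology on $B^B$ with $B$ discrete), and every submonoid of $\mathfrak{T}_B$ (such as $\operatorname{End}(\mathbf{B})$) carries the subspace topology. Weak orbits: for a transformation monoid $\mathfrak{M}\le\mathfrak{T}_B$ and $a,b\in B$, put $a\preceq b$ if there is $m\in\mathfrak{M}$ with $m(b)=a$. The weak orbits of $\mathfrak{M}$ on $B$ are the classes of the least equivalence relation on $B$ containing $\preceq$. *)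

theory Defs
  imports "HOL-Analysis.Analysis" "HOL-Algebra.Group"
begin

text \<open>
  The signature is the set \<open>symbols\<close> with its \<open>arity\<close> function; tuples are lists.
  Values of \<open>arity\<close> and \<open>interp\<close> outside \<open>symbols\<close> are irrelevant.
\<close>

record ('i, 'b) rel_struct =
  universe :: "'b set"
  symbols :: "'i set"
  arity :: "'i \<Rightarrow> nat"
  interp :: "'i \<Rightarrow> 'b list set"

definition relational_structure :: "('i, 'b) rel_struct \<Rightarrow> bool" where
  "relational_structure \<B> \<longleftrightarrow>
     (\<forall>s\<in>symbols \<B>. interp \<B> s \<subseteq> {xs \<in> lists (universe \<B>). length xs = arity \<B> s})"

text \<open>
  Maps \<open>B \<rightarrow> B\<close> are represented as extensional functions, which is also how
  the points of the library product topology are represented.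
\<close>

definition full_transformation_monoid :: "'b set \<Rightarrow> ('b \<Rightarrow> 'b) monoid" where
  "full_transformation_monoid B =
     \<lparr>carrier = B \<rightarrow>\<^sub>E B, mult = (\<lambda>f g. compose B f g), one = (\<lambda>x\<in>B. x)\<rparr>"

definition endomorphisms :: "('i, 'b) rel_struct \<Rightarrow> ('b \<Rightarrow> 'b) set" where
  "endomorphisms \<B> =
     {f \<in> universe \<B> \<rightarrow>\<^sub>E universe \<B>.
        \<forall>s\<in>symbols \<B>. \<forall>xs\<in>interp \<B> s. map f xs \<in> interp \<B> s}"

definition End :: "('i, 'b) rel_struct \<Rightarrow> ('b \<Rightarrow> 'b) monoid" where
  "End \<B> = (full_transformation_monoid (universe \<B>)) \<lparr>carrier := endomorphisms \<B>\<rparr>"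

definition pointwise_topology :: "'b set \<Rightarrow> ('b \<Rightarrow> 'b) topology" where
  "pointwise_topology B = product_topology (\<lambda>_. discrete_topology B) B"

definition End_topology :: "('i, 'b) rel_struct \<Rightarrow> ('b \<Rightarrow> 'b) topology" where
  "End_topology \<B> = subtopology (pointwise_topology (universe \<B>)) (carrier (End \<B>))"

definition weak_preorder :: "('b \<Rightarrow> 'b) set \<Rightarrow> 'b set \<Rightarrow> 'b rel" where
  "weak_preorder M B = {(a, b). a \<in> B \<and> b \<in> B \<and> (\<exists>m\<in>M. m b = a)}"

definition weak_orbit_equiv :: "('b \<Rightarrow> 'b) set \<Rightarrow> 'b set \<Rightarrow> 'b rel" where
  "weak_orbit_equiv M B = \<Inter>{E. equiv B E \<and> weak_preorder M B \<subseteq> E}"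

definition weak_orbits :: "('b \<Rightarrow> 'b) set \<Rightarrow> 'b set \<Rightarrow> 'b set set" where
  "weak_orbits M B = B // weak_orbit_equiv M B"

definition rat_le :: "(unit, rat) rel_struct" where
  "rat_le = \<lparr>universe = UNIV, symbols = {()}, arity = (\<lambda>_. 2),
             interp = (\<lambda>_. {[x, y] | x y. x \<le> y})\<rparr>"

lemma relational_structure_rat_le: "relational_structure rat_le"
  by (auto simp: relational_structure_def rat_le_def)

lemma carrier_End_rat_le: "carrier (End rat_le) = {f. mono f}"
proof -
  have "(\<forall>xs\<in>{[x, y] | x y. x \<le> y}. map f xs \<in> {[x, y] | x y. x \<le> y}) \<longleftrightarrow> mono f"
    for f :: "rat \<Rightarrow> rat"
    unfolding mono_def by auto
  then show ?thesis
    by (simp add: End_def full_transformation_monoid_def endomorphisms_def rat_le_def)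
qed

lemma monoid_full_transformation_monoid: "monoid (full_transformation_monoid B)"
  unfolding full_transformation_monoid_def
  by (rule monoidI) (auto simp: compose_def PiE_iff extensional_def restrict_def fun_eq_iff)

lemma map_preserves_universe:
  fixes f g :: "'b \<Rightarrow> 'b"
  assumes "relational_structure \<B>" "s \<in> symbols \<B>" "xs \<in> interp \<B> s"
  shows "map (compose (universe \<B>) f g) xs = map f (map g xs)"
    and "map (\<lambda>x\<in>universe \<B>. x) xs = xs"
proof -
  have "set xs \<subseteq> universe \<B>"
    using assms unfolding relational_structure_def by blast
  then show "map (compose (universe \<B>) f g) xs = map f (map g xs)"
    and "map (\<lambda>x\<in>universe \<B>. x) xs = xs"
    by (auto simp: compose_def intro!: map_idI)
qed

lemma monoid_End:
  assumes "relational_structure \<B>"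
  shows "monoid (End \<B>)"
proof -
  let ?T = "full_transformation_monoid (universe \<B>)"
  interpret T: monoid ?T
    by (rule monoid_full_transformation_monoid)
  have sub: "endomorphisms \<B> \<subseteq> carrier ?T"
    unfolding endomorphisms_def full_transformation_monoid_def by auto
  have one: "\<one>\<^bsub>?T\<^esub> \<in> endomorphisms \<B>"
    using map_preserves_universe(2)[OF assms] T.one_closed
    unfolding endomorphisms_def full_transformation_monoid_def by simp
  have mult: "f \<otimes>\<^bsub>?T\<^esub> g \<in> endomorphisms \<B>"
    if "f \<in> endomorphisms \<B>" "g \<in> endomorphisms \<B>" for f g
  proof -
    have "f \<otimes>\<^bsub>?T\<^esub> g \<in> carrier ?T"
      using that sub by (blast intro: T.m_closed)
    then show ?thesis
      using map_preserves_universe(1)[OF assms] that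
      unfolding endomorphisms_def full_transformation_monoid_def by (simp del: map_map map_eq_conv)
  qed
  show ?thesis
    unfolding End_def
  proof (rule monoidI, goal_cases)
    case (3 x y z)
    then show ?case using sub T.m_assoc[of x y z] by auto
  next
    case (4 x)
    then show ?case using sub T.l_one[of x] by auto
  next
    case (5 x)
    then show ?case using sub T.r_one[of x] by auto
  qed (use one mult in auto)
qed

lemma topspace_End_topology: "topspace (End_topology \<B>) = carrier (End \<B>)"
  unfolding End_topology_def pointwise_topology_def End_def endomorphisms_def
  by auto

lemma equiv_weak_orbit_equiv: "equiv B (weak_orbit_equiv M B)"
proof -
  have "equiv B (B \<times> B)" "weak_preorder M B \<subseteq> B \<times> B"
    by (auto simp: equiv_def refl_on_def sym_def trans_def weak_preorder_def)
  then have "weak_orbit_equiv M B \<subseteq> B \<times> B"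
    unfolding weak_orbit_equiv_def by blast
  moreover have "refl_on B (weak_orbit_equiv M B)"
    unfolding weak_orbit_equiv_def refl_on_def equiv_def by blast
  moreover have "sym (weak_orbit_equiv M B)"
    unfolding weak_orbit_equiv_def by (rule symI) (auto simp: equiv_def dest: symD)
  moreover have "trans (weak_orbit_equiv M B)"
    unfolding weak_orbit_equiv_def by (rule transI) (auto simp: equiv_def dest: transD)
  ultimately show ?thesis
    by (simp add: equiv_def)
qed

end

theory Submission
  imports Defs
begin

text \<open>
  An isomorphism \<open>h\<close> makes the monotone maps of the rationals act on the countable set \<open>B\<close>, and two
  things have to be shown: finitely many values of \<open>h f\<close> determine \<open>f q\<close> (continuity of the inverse),
  and finitely many values of \<open>f\<close> determine \<open>h f b\<close> (continuity of \<open>h\<close>).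

  The first is the place where the weak orbits matter. A constant map absorbs everything composed on
  its right, so its image under \<open>h\<close> is constant on every weak orbit and is known from
  finitely many values. Since \<open>f\<close> sends the constant map with value \<open>q\<close> to the one with value
  \<open>f q\<close>, the action of \<open>f\<close> on those finitely many values reveals \<open>f q\<close>
  (\<open>iso_rational_endomorphism_action\<close>).

  The second uses that endomorphism monoids are closed under pointwise limits. With the
  first part this gives the principle \<open>act_limit\<close>: if \<open>w n\<close> tends to \<open>f\<close> and the actions of the \<open>w n\<close>
  converge at all, they converge to the action of \<open>f\<close>. On the automorphism group, a Polish group,
  point stabilisers have countable index. Baire category makes them dense in a
  neighbourhood of the identity (\<open>stabiliser_dense\<close>), and successive approximation with the limit
  principle makes them open (\<open>stabiliser_open\<close>). This is the proof of the open mapping theorem for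
  Polish groups, run inside the monoid.

  To pass from automorphisms to all monotone maps, identify the rationals with their
  lexicographic square and let \<open>s\<close> be the first projection. Every monotone \<open>f\<close> is \<open>s\<close> composed
  with the embedding that sends \<open>x\<close> to the pair of \<open>f x\<close> and \<open>x\<close>; the latter is a limit of automorphisms,
  so \<open>f\<close> is a limit of maps \<open>s \<circ> v\<close> with \<open>v\<close> an automorphism, and the limit principle
  applies again (\<open>act_local\<close>).
\<close>

section \<open>Pointwise convergence\<close>

lemma openin_pointwise_subtopology:
  assumes S: "S \<subseteq> A \<rightarrow>\<^sub>E A"
  shows "openin (subtopology (pointwise_topology A) S) U \<longleftrightarrow>
    U \<subseteq> S \<and> (\<forall>f\<in>U. \<exists>F. finite F \<and> F \<subseteq> A \<and> (\<forall>g\<in>S. (\<forall>x\<in>F. g x = f x) \<longrightarrow> g \<in> U))"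
    (is "?L \<longleftrightarrow> ?R")
proof
  assume ?L
  then obtain T where T: "openin (pointwise_topology A) T" and U: "U = T \<inter> S"
    by (auto simp: openin_subtopology)
  show ?R
  proof (intro conjI ballI)
    fix f assume f: "f \<in> U"
    then have "f \<in> T" using U by auto
    then obtain X where X: "f \<in> (\<Pi>\<^sub>E i\<in>A. X i)" "finite {i. X i \<noteq> A}" "(\<Pi>\<^sub>E i\<in>A. X i) \<subseteq> T"
      using product_topology_open_contains_basis[OF T[unfolded pointwise_topology_def] \<open>f \<in> T\<close>]
      unfolding topspace_discrete_topology by blast
    show "\<exists>F. finite F \<and> F \<subseteq> A \<and> (\<forall>g\<in>S. (\<forall>x\<in>F. g x = f x) \<longrightarrow> g \<in> U)"
    proof (intro exI conjI ballI impI)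
      show "finite ({i. X i \<noteq> A} \<inter> A)" "{i. X i \<noteq> A} \<inter> A \<subseteq> A" using X by auto
      fix g assume g: "g \<in> S" "\<forall>x\<in>{i. X i \<noteq> A} \<inter> A. g x = f x"
      have "g \<in> A \<rightarrow>\<^sub>E A" using g S by auto
      moreover have "g x \<in> X x" if "x \<in> A" for x
      proof (cases "X x = A")
        case True
        then show ?thesis using that \<open>g \<in> A \<rightarrow>\<^sub>E A\<close> by auto
      next
        case False
        then show ?thesis using g(2) that X(1) by auto
      qed
      ultimately have "g \<in> (\<Pi>\<^sub>E i\<in>A. X i)" by (auto simp: PiE_iff)
      then show "g \<in> U" using X U g by auto
    qed
  qed (use U in auto)
next
  assume R: ?R
  show ?L
  proof (subst openin_subopen, intro ballI)
    fix f assume f: "f \<in> U"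
    then obtain F where F: "finite F" "F \<subseteq> A" "\<forall>g\<in>S. (\<forall>x\<in>F. g x = f x) \<longrightarrow> g \<in> U"
      using R by meson
    have fA: "f \<in> A \<rightarrow>\<^sub>E A" using f R S by auto
    define T where "T = (\<Pi>\<^sub>E i\<in>A. if i \<in> F then {f i} else A)"
    have "openin (pointwise_topology A) T"
      unfolding pointwise_topology_def T_def openin_PiE_gen
      using fA F by (auto intro: finite_subset[OF _ F(1)])
    moreover have "T \<inter> S \<subseteq> U" using F by (fastforce simp: T_def PiE_iff)
    moreover have "f \<in> T \<inter> S" using f R fA by (auto simp: T_def PiE_iff)
    ultimately show "\<exists>T. openin (subtopology (pointwise_topology A) S) T \<and> f \<in> T \<and> T \<subseteq> U"
      by (auto simp: openin_subtopology)
  qed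
qed

lemma topspace_pointwise_subtopology:
  "S \<subseteq> A \<rightarrow>\<^sub>E A \<Longrightarrow> topspace (subtopology (pointwise_topology A) S) = S"
  by (auto simp: pointwise_topology_def)

lemma continuous_map_pointwise:
  assumes S: "S \<subseteq> A \<rightarrow>\<^sub>E A" and T: "T \<subseteq> B \<rightarrow>\<^sub>E B" and "\<phi> ` S \<subseteq> T"
    and local: "\<And>b f. b \<in> B \<Longrightarrow> f \<in> S \<Longrightarrow>
      \<exists>F. finite F \<and> F \<subseteq> A \<and> (\<forall>g\<in>S. (\<forall>x\<in>F. g x = f x) \<longrightarrow> \<phi> g b = \<phi> f b)"
  shows "continuous_map (subtopology (pointwise_topology A) S)
                        (subtopology (pointwise_topology B) T) \<phi>"
proof -
  have open_preimage: "openin (subtopology (pointwise_topology A) S) {f \<in> S. \<phi> f \<in> U}"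
    if "openin (subtopology (pointwise_topology B) T) U" for U
  proof -
    from that have U: "\<forall>f\<in>U. \<exists>F. finite F \<and> F \<subseteq> B \<and> (\<forall>g\<in>T. (\<forall>x\<in>F. g x = f x) \<longrightarrow> g \<in> U)"
      by (rule openin_pointwise_subtopology[OF T, THEN iffD1, THEN conjunct2])
    have "\<exists>F. finite F \<and> F \<subseteq> A \<and> (\<forall>g\<in>S. (\<forall>x\<in>F. g x = f x) \<longrightarrow> g \<in> {f \<in> S. \<phi> f \<in> U})"
      if f: "f \<in> S" "\<phi> f \<in> U" for f
    proof -
      obtain F where F: "finite F" "F \<subseteq> B" "\<forall>g\<in>T. (\<forall>x\<in>F. g x = \<phi> f x) \<longrightarrow> g \<in> U"
        using bspec[OF U f(2)] by (elim exE conjE)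
      have "\<forall>b\<in>F. \<exists>G. finite G \<and> G \<subseteq> A \<and> (\<forall>g\<in>S. (\<forall>x\<in>G. g x = f x) \<longrightarrow> \<phi> g b = \<phi> f b)"
        using F(2) by (intro ballI local f(1)) (rule subsetD)
      then obtain G where G: "\<forall>b\<in>F. finite (G b) \<and> G b \<subseteq> A \<and>
          (\<forall>g\<in>S. (\<forall>x\<in>G b. g x = f x) \<longrightarrow> \<phi> g b = \<phi> f b)"
        by (rule bchoice[THEN exE])
      show ?thesis
      proof (intro exI conjI ballI impI)
        show "finite (\<Union>b\<in>F. G b)" "(\<Union>b\<in>F. G b) \<subseteq> A" using F(1) G by auto
        fix g assume g: "g \<in> S" "\<forall>x\<in>(\<Union>b\<in>F. G b). g x = f x"
        have "\<phi> g b = \<phi> f b" if "b \<in> F" for b using g G that by auto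
        moreover have "\<phi> g \<in> T" using g assms(3) by blast
        ultimately show "g \<in> {f \<in> S. \<phi> f \<in> U}" using g(1) F(3) by simp
      qed
    qed
    then show ?thesis
      by (subst openin_pointwise_subtopology[OF S]) simp
  qed
  have "\<phi> \<in> S \<rightarrow> T" using assms(3) by blast
  then show ?thesis
    using open_preimage
    by (simp only: continuous_map_def topspace_pointwise_subtopology[OF S]
        topspace_pointwise_subtopology[OF T] simp_thms) blast
qed

section \<open>Back and forth between countable dense orders\<close>

definition order_matching :: "('a::linorder \<times> 'b::linorder) set \<Rightarrow> bool" where
  "order_matching p \<longleftrightarrow> 
     (\<forall>x y x' y'. (x, y) \<in> p \<longrightarrow> (x', y') \<in> p \<longrightarrow> (x < x' \<longleftrightarrow> y < y'))"

lemma order_matching_converse: "order_matching (p\<inverse>) \<longleftrightarrow> order_matching p"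
  unfolding order_matching_def converse_iff by blast

lemma exists_between_finite_sets:
  fixes L U :: "'b::unbounded_dense_linorder set"
  assumes "finite L" "finite U" "\<And>l u. l \<in> L \<Longrightarrow> u \<in> U \<Longrightarrow> l < u"
  shows "\<exists>y. (\<forall>l\<in>L. l < y) \<and> (\<forall>u\<in>U. y < u)"
proof (cases "L = {}")
  case True
  show ?thesis
  proof (cases "U = {}")
    case False
    obtain y where "y < Min U" using lt_ex by blast
    then show ?thesis using True False assms(2) by auto
  qed (use True in auto)
next
  case L: False
  show ?thesis
  proof (cases "U = {}")
    case True
    obtain y where "y > Max L" using gt_ex by blast
    then show ?thesis using True L assms(1) by auto
  next
    case False
    have "Max L < Min U" using assms False L by simp
    then obtain y where "Max L < y" "y < Min U" using dense by blast
    then show ?thesis using False L assms by auto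
  qed
qed

lemma order_matching_extend:
  fixes p :: "('a::linorder \<times> 'b::unbounded_dense_linorder) set"
  assumes "finite p" "order_matching p"
  shows "\<exists>y. order_matching (insert (x, y) p)"
proof (cases "x \<in> Domain p")
  case True
  then obtain y where "(x, y) \<in> p" by blast
  then show ?thesis using assms(2) by (auto simp: insert_absorb intro: exI[of _ y])
next
  case False
  define L U where "L = snd ` {z\<in>p. fst z < x}" and "U = snd ` {z\<in>p. x < fst z}"
  have "l < u" if lu: "l \<in> L" "u \<in> U" for l u
  proof -
    obtain a a' where "(a, l) \<in> p" "a < x" "(a', u) \<in> p" "x < a'"
      using lu by (auto simp: L_def U_def)
    then show ?thesis using assms(2) by (meson order_matching_def less_trans)
  qed
  then obtain y where y: "\<forall>l\<in>L. l < y" "\<forall>u\<in>U. y < u"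
    using exists_between_finite_sets[of L U] assms(1) by (auto simp: L_def U_def)
  have cmp: "(x < a \<longleftrightarrow> y < b) \<and> (a < x \<longleftrightarrow> b < y)" if "(a, b) \<in> p" for a b
  proof (cases "a < x")
    case True
    then have "b \<in> L" using that by (force simp: L_def)
    then show ?thesis using True y(1) by force
  next
    case F: False
    have "a \<noteq> x" using that False by auto
    then have "x < a" using F by auto
    then have "b \<in> U" using that by (force simp: U_def)
    then show ?thesis using \<open>x < a\<close> y(2) by force
  qed
  have "order_matching (insert (x, y) p)"
    unfolding order_matching_def
  proof (intro allI impI)
    fix a b a' b' assume "(a, b) \<in> insert (x, y) p" "(a', b') \<in> insert (x, y) p"
    then show "a < a' \<longleftrightarrow> b < b'"
      using cmp[of a b] cmp[of a' b'] assms(2)[unfolded order_matching_def, rule_format, of a b a' b']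
      by (elim insertE) simp_all
  qed
  then show ?thesis ..
qed

text \<open>
  Back and forth: enumerate both orders and enlarge the finite matching alternately on either side.
  The empty matching gives Cantor's theorem that any two such orders are isomorphic; with both
  orders equal to the rationals, it gives the homogeneity of the rationals.
\<close>

theorem order_isomorphism_extending:
  fixes p :: "('a::{unbounded_dense_linorder,countable} \<times> 'b::{unbounded_dense_linorder,countable}) set"
  assumes "finite p" "order_matching p"
  shows "\<exists>f. strict_mono f \<and> surj f \<and> (\<forall>(x, y)\<in>p. f x = y)"
proof -
  have step: "\<exists>p'. (finite p' \<and> order_matching p') \<and> p \<subseteq> p' \<and> from_nat n \<in> Domain p' \<and> from_nat n \<in> Range p'"
    if p: "finite p \<and> order_matching p" for p :: "('a \<times> 'b) set" and n
  proof -
    obtain y where y: "order_matching (insert (from_nat n, y) p)"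
      using order_matching_extend p by blast
    moreover have "finite ((insert (from_nat n, y) p)\<inverse>)" using p by simp
    ultimately obtain x where "order_matching (insert (from_nat n, x) ((insert (from_nat n, y) p)\<inverse>))"
      using order_matching_extend order_matching_converse by blast
    moreover have "insert (from_nat n, x) ((insert (from_nat n, y) p)\<inverse>) =
        (insert (x, from_nat n) (insert (from_nat n, y) p))\<inverse>" by auto
    ultimately have "order_matching (insert (x, from_nat n) (insert (from_nat n, y) p))"
      by (simp only: order_matching_converse)
    then show ?thesis
      using p by (intro exI[of _ "insert (x, from_nat n) (insert (from_nat n, y) p)"]) auto
  qed
  have "\<exists>P. \<forall>n. ((finite (P n) \<and> order_matching (P n)) \<and> (n = 0 \<longrightarrow> P n = p)) \<and>
      P n \<subseteq> P (Suc n) \<and> from_nat n \<in> Domain (P (Suc n)) \<and> from_nat n \<in> Range (P (Suc n))"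
    by (rule dependent_nat_choice) (use assms step in auto)
  then obtain P where P0: "P 0 = p" and P: "\<And>n. finite (P n) \<and> order_matching (P n)"
    and PS: "\<And>n. P n \<subseteq> P (Suc n) \<and> from_nat n \<in> Domain (P (Suc n)) \<and> from_nat n \<in> Range (P (Suc n))"
    by blast
  define R where "R = (\<Union>n. P n)"
  have mono: "P m \<subseteq> P n" if "m \<le> n" for m n using lift_Suc_mono_le[of P] PS that by blast
  have R: "x < x' \<longleftrightarrow> y < y'" if R2: "(x, y) \<in> R" "(x', y') \<in> R" for x y x' y'
  proof -
    obtain m n where "(x, y) \<in> P m" "(x', y') \<in> P n" using R2 by (auto simp: R_def)
    then have "(x, y) \<in> P (max m n)" "(x', y') \<in> P (max m n)"
      using mono max.cobounded1 max.cobounded2 by blast+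
    then show ?thesis using P[of "max m n"] by (auto simp: order_matching_def)
  qed
  have dom: "\<exists>y. (x, y) \<in> R" for x :: 'a
    using PS[of "to_nat x"] by (auto simp: R_def)
  have rng: "\<exists>x. (x, y) \<in> R" for y :: 'b
    using PS[of "to_nat y"] by (auto simp: R_def)
  obtain f where f: "\<And>x. (x, f x) \<in> R" using dom by metis
  have uniq: "y = f x" if "(x, y) \<in> R" for x y
    using R[OF that f[of x]] R[OF f[of x] that] by (metis less_irrefl linorder_neqE)
  have "strict_mono f" using R[OF f f] by (auto simp: strict_mono_def)
  moreover have "surj f" using rng uniq by (metis surjI)
  moreover have "\<forall>(x, y)\<in>p. f x = y" using uniq P0 by (force simp: R_def)
  ultimately show ?thesis by blast
qed

section \<open>Monotone maps and automorphisms of the rationals\<close>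

definition automorphisms_rat :: "(rat \<Rightarrow> rat) set" where
  "automorphisms_rat = {g. strict_mono g \<and> surj g}"

lemma exists_automorphism_agreeing:
  fixes e :: "rat \<Rightarrow> rat"
  assumes "strict_mono e" "finite F"
  shows "\<exists>g\<in>automorphisms_rat. \<forall>x\<in>F. g x = e x"
proof -
  have "order_matching ((\<lambda>x. (x, e x)) ` F)"
    using assms(1) by (auto simp: order_matching_def strict_mono_less)
  from order_isomorphism_extending[OF finite_imageI[OF assms(2)] this]
  obtain g where "strict_mono g" "surj g" "\<forall>(x, y)\<in>(\<lambda>x. (x, e x)) ` F. g x = y"
    by (elim exE conjE)
  then show ?thesis by (auto simp: automorphisms_rat_def)
qed

text \<open>
  A fresh type carries the lexicographic order, because the product type \<open>rat \<times> rat\<close> is already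
  ordered componentwise.
\<close>

datatype lex_rat = Lex rat rat

instantiation lex_rat :: linorder
begin

fun less_lex_rat :: "lex_rat \<Rightarrow> lex_rat \<Rightarrow> bool" where
  "less_lex_rat (Lex a b) (Lex c d) \<longleftrightarrow> a < c \<or> a = c \<and> b < d"

definition "x \<le> y \<longleftrightarrow> x < y \<or> x = y" for x y :: lex_rat

instance
proof
  fix x y z :: lex_rat
  show "x < y \<longleftrightarrow> x \<le> y \<and> \<not> y \<le> x" "x \<le> x" "x \<le> y \<or> y \<le> x"
    by (cases x; cases y; auto simp: less_eq_lex_rat_def)+
  show "x \<le> y \<Longrightarrow> y \<le> x \<Longrightarrow> x = y"
    by (cases x; cases y; auto simp: less_eq_lex_rat_def)
  show "x \<le> y \<Longrightarrow> y \<le> z \<Longrightarrow> x \<le> z"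
    by (cases x; cases y; cases z; auto simp: less_eq_lex_rat_def)
qed

end

instance lex_rat :: unbounded_dense_linorder
proof
  fix x y :: lex_rat
  obtain a b where x: "x = Lex a b" by (cases x)
  show "\<exists>z. x < z" using gt_ex[of b] x by (metis less_lex_rat.simps)
  show "\<exists>z. z < x" using lt_ex[of b] x by (metis less_lex_rat.simps)
  assume xy: "x < y"
  obtain c d where y: "y = Lex c d" by (cases y)
  show "\<exists>z. x < z \<and> z < y"
  proof (cases "a < c")
    case True
    obtain e where "b < e" using gt_ex by blast
    then show ?thesis using True x y by (intro exI[of _ "Lex a e"]) simp
  next
    case False
    then have "a = c" "b < d" using xy x y by auto
    then obtain e where "b < e" "e < d" using dense by blast
    then show ?thesis using \<open>a = c\<close> x y by (intro exI[of _ "Lex a e"]) simp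
  qed
qed

instance lex_rat :: countable
  by countable_datatype

text \<open>
  By Cantor's theorem the rationals are isomorphic to their lexicographic square, and \<open>s\<close> is the
  projection of that square to the first coordinate; \<open>k y\<close> embeds the rationals into the fibre
  of \<open>s\<close> over \<open>y\<close>. Thus every monotone \<open>f\<close> is the one map \<open>s\<close> composed with an embedding,
  namely the graph of \<open>f\<close>, and the value of this embedding at \<open>x\<close> depends only on \<open>x\<close> and \<open>f x\<close>.
  That locality lets continuity pass from embeddings to all monotone maps.
\<close>

lemma exists_universal_mono_map:
  "\<exists>(s :: rat \<Rightarrow> rat) k. mono s \<and> (\<forall>y x. s (k y x) = y) \<and>
     (\<forall>f. mono f \<longrightarrow> strict_mono (\<lambda>x :: rat. k (f x) x))"
proof -
  obtain \<phi> :: "lex_rat \<Rightarrow> rat" where \<phi>: "strict_mono \<phi>" "surj \<phi>"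
    using order_isomorphism_extending[of "{} :: (lex_rat \<times> rat) set"] by (auto simp: order_matching_def)
  define s where "s q = (case inv_into UNIV \<phi> q of Lex a b \<Rightarrow> a)" for q
  have s: "s (\<phi> (Lex a b)) = a" for a b
    using \<phi>(1) by (simp add: s_def strict_mono_imp_inj_on inv_into_f_f)
  have "mono s"
  proof (rule monoI)
    fix x y :: rat assume "x \<le> y"
    moreover obtain z z' where z: "x = \<phi> z" "y = \<phi> z'" using \<phi>(2) by (metis surjD)
    ultimately have "z \<le> z'" using \<phi>(1) by (simp add: strict_mono_less_eq)
    then show "s x \<le> s y"
      by (cases z; cases z') (auto simp: z s less_eq_lex_rat_def)
  qed
  moreover have "strict_mono (\<lambda>x. \<phi> (Lex (f x) x))" if "mono f" for f :: "rat \<Rightarrow> rat"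
  proof (rule strict_monoI)
    fix x y :: rat assume "x < y"
    moreover have "f x \<le> f y" using \<open>mono f\<close> \<open>x < y\<close> by (simp add: mono_def)
    ultimately show "\<phi> (Lex (f x) x) < \<phi> (Lex (f y) y)"
      using \<phi>(1) by (simp add: strict_mono_less order_le_less)
  qed
  ultimately show ?thesis
    using s by (intro exI[of _ s] exI[of _ "\<lambda>y x. \<phi> (Lex y x)"]) blast
qed

text \<open>
  The automorphisms are a countable intersection of open sets of maps: for each pair \<open>x < y\<close>
  the condition \<open>f x < f y\<close>, and for each \<open>q\<close> the condition that \<open>q\<close> is attained.
\<close>

lemma completely_metrizable_space_automorphisms_rat:
  "completely_metrizable_space (subtopology (pointwise_topology UNIV) automorphisms_rat)"
proof (rule completely_metrizable_space_gdelta_in)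
  let ?X = "pointwise_topology (UNIV :: rat set)"
  show "completely_metrizable_space ?X"
    unfolding pointwise_topology_def completely_metrizable_space_product_topology
    by (simp add: completely_metrizable_space_discrete_topology)
  have open_iff: "openin ?X U \<longleftrightarrow>
      (\<forall>f\<in>U. \<exists>F. finite F \<and> (\<forall>g. (\<forall>x\<in>F. g x = f x) \<longrightarrow> g \<in> U))" for U
    using openin_pointwise_subtopology[of UNIV UNIV U] by simp
  define I where "I = {(x, y :: rat). x < y}"
  define lt where "lt = (\<lambda>(x, y). {f :: rat \<Rightarrow> rat. f x < f y})"
  define hit where "hit q = {f :: rat \<Rightarrow> rat. q \<in> range f}" for q
  have "openin ?X (lt z)" for z
    unfolding open_iff
    by (cases z) (auto simp: lt_def intro!: exI[of _ "{fst z, snd z}"])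
  moreover have "openin ?X (hit q)" for q
    unfolding open_iff
  proof
    fix f assume "f \<in> hit q"
    then obtain x where x: "f x = q" by (auto simp: hit_def)
    have "g \<in> hit q" if "g x = f x" for g using that x by (auto simp: hit_def)
    then show "\<exists>F. finite F \<and> (\<forall>g. (\<forall>x\<in>F. g x = f x) \<longrightarrow> g \<in> hit q)"
      by (intro exI[of _ "{x}"]) auto
  qed
  moreover have automorphisms_eq: "automorphisms_rat = \<Inter> (lt ` I \<union> range hit)"
  proof -
    have "strict_mono f \<longleftrightarrow> (\<forall>z\<in>I. f \<in> lt z)" for f
      by (auto simp: strict_mono_def I_def lt_def)
    moreover have "surj f \<longleftrightarrow> (\<forall>q. f \<in> hit q)" for f
      by (auto simp: hit_def)
    ultimately show ?thesis by (auto simp: automorphisms_rat_def)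
  qed
  ultimately have open_sets: "openin ?X U" if "U \<in> lt ` I \<union> range hit" for U
    using that by blast
  show "gdelta_in ?X automorphisms_rat"
    unfolding automorphisms_eq
  proof (rule gdelta_in_Inter)
    show "gdelta_in ?X U" if "U \<in> lt ` I \<union> range hit" for U
      using open_imp_gdelta_in open_sets that by blast
  qed auto
qed

text \<open>
  The Baire category theorem, with closures and interiors spelled out: the automorphisms near
  \<open>g\<^sub>0\<close>, that is, agreeing with it on \<open>F\<close>, are all in the closure of the member \<open>S\<close>.
\<close>

lemma somewhere_dense_cover_member:
  assumes "countable \<C>" "\<Union>\<C> = automorphisms_rat"
  shows "\<exists>S\<in>\<C>. \<exists>g\<^sub>0\<in>automorphisms_rat. \<exists>F. finite F \<and>
    (\<forall>g\<in>automorphisms_rat. (\<forall>x\<in>F. g x = g\<^sub>0 x) \<longrightarrow>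
       (\<forall>F'. finite F' \<longrightarrow> (\<exists>v\<in>S. \<forall>x\<in>F'. v x = g x)))"
proof -
  let ?X = "subtopology (pointwise_topology UNIV) automorphisms_rat"
  have top: "topspace ?X = automorphisms_rat"
    by (rule topspace_pointwise_subtopology) simp
  have open_iff: "openin ?X U \<longleftrightarrow> U \<subseteq> automorphisms_rat \<and>
      (\<forall>f\<in>U. \<exists>F. finite F \<and> (\<forall>g\<in>automorphisms_rat. (\<forall>x\<in>F. g x = f x) \<longrightarrow> g \<in> U))" for U
    using openin_pointwise_subtopology[of automorphisms_rat UNIV U] by simp
  have "automorphisms_rat \<subseteq> \<Union> ((closure_of) ?X ` \<C>)"
    using assms(2) closure_of_subset[of _ ?X] unfolding top by blast
  moreover have "\<Union> ((closure_of) ?X ` \<C>) \<subseteq> automorphisms_rat"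
    using closure_of_subset_topspace[of ?X] unfolding top by blast
  ultimately have un: "\<Union> ((closure_of) ?X ` \<C>) = topspace ?X" unfolding top by blast
  have id: "id \<in> automorphisms_rat" by (simp add: automorphisms_rat_def strict_mono_def)
  have "?X interior_of \<Union> ((closure_of) ?X ` \<C>) \<noteq> {}"
    unfolding un interior_of_topspace unfolding top using id by blast
  then have "\<exists>T\<in>(closure_of) ?X ` \<C>. \<not> (closedin ?X T \<and> ?X interior_of T = {})"
    using Baire_category_alt[of ?X "(closure_of) ?X ` \<C>"]
      completely_metrizable_space_automorphisms_rat countable_image[OF assms(1)] by meson
  then obtain S where S: "S \<in> \<C>" "?X interior_of (?X closure_of S) \<noteq> {}"
    by (elim bexE imageE) (simp add: closedin_closure_of)
  define U where "U = ?X interior_of (?X closure_of S)"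
  have U: "openin ?X U" "U \<subseteq> ?X closure_of S" by (simp_all add: U_def interior_of_subset)
  obtain g0 where g0: "g0 \<in> U" using S(2) by (auto simp: U_def)
  have g0_aut: "g0 \<in> automorphisms_rat" using openin_subset[OF U(1)] g0 unfolding top by blast
  obtain F where F: "finite F"
      "\<forall>g\<in>automorphisms_rat. (\<forall>x\<in>F. g x = g0 x) \<longrightarrow> g \<in> U"
    using bspec[OF open_iff[THEN iffD1, OF U(1), THEN conjunct2] g0] by (elim exE conjE)
  have dense: "\<exists>v\<in>S. \<forall>x\<in>F'. v x = g x" if g: "g \<in> ?X closure_of S" and F': "finite F'" for g F'
  proof -
    let ?W = "{v\<in>automorphisms_rat. \<forall>x\<in>F'. v x = g x}"
    have "openin ?X ?W" unfolding open_iff using F' by (auto intro!: exI[of _ F'])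
    moreover have "g \<in> ?W" using g closure_of_subset_topspace[of ?X S] unfolding top by blast
    ultimately obtain v where "v \<in> S" "v \<in> ?W" using g unfolding in_closure_of by meson
    then show ?thesis by blast
  qed
  show ?thesis
  proof (intro bexI[OF _ S(1)] bexI[OF _ g0_aut] exI[of _ F] conjI ballI impI allI F(1))
    fix g and F' :: "rat set"
    assume "g \<in> automorphisms_rat" "\<forall>x\<in>F. g x = g0 x" "finite F'"
    then show "\<exists>v\<in>S. \<forall>x\<in>F'. v x = g x"
      using dense[OF subsetD[OF U(2)]] F(2) by simp
  qed
qed

section \<open>Closed actions of the monotone maps on a countable set\<close>

lemma automorphisms_rat_mono: "g \<in> automorphisms_rat \<Longrightarrow> mono g"
  by (simp add: automorphisms_rat_def strict_mono_mono)

lemma automorphisms_rat_id: "id \<in> automorphisms_rat"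
  by (simp add: automorphisms_rat_def strict_mono_def)

lemma automorphisms_rat_comp:
  "f \<in> automorphisms_rat \<Longrightarrow> g \<in> automorphisms_rat \<Longrightarrow> f \<circ> g \<in> automorphisms_rat"
  using comp_surj[of g f] by (simp add: automorphisms_rat_def strict_mono_def)

lemma automorphisms_rat_inverse:
  assumes "g \<in> automorphisms_rat"
  shows "\<exists>u\<in>automorphisms_rat. u \<circ> g = id \<and> g \<circ> u = id"
proof -
  have g: "strict_mono g" "surj g" using assms by (auto simp: automorphisms_rat_def)
  define u where "u = inv_into UNIV g"
  have ug: "u (g x) = x" for x using g(1) by (simp add: u_def strict_mono_imp_inj_on)
  have gu: "g (u x) = x" for x using g(2) by (simp add: u_def surj_f_inv_f)
  have "strict_mono u"
    by (rule strict_monoI) (metis gu g(1) strict_mono_less)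
  moreover have "surj u" using ug by (metis surjI)
  ultimately show ?thesis
    using ug gu by (intro bexI[of _ u]) (auto simp: automorphisms_rat_def fun_eq_iff)
qed

text \<open>
  The monotone maps act on \<open>B\<close> through \<open>h\<close>. The assumption \<open>act_closed\<close> says that the image of
  the action is closed under pointwise limits, and \<open>act_reconstructs\<close> that the action
  topology is at least as fine as pointwise convergence on the rationals. They work together:
  closedness provides a limit in the image, and reconstruction identifies its preimage.
\<close>

locale rational_endomorphism_action =
  fixes B :: "'b set" and h :: "(rat \<Rightarrow> rat) \<Rightarrow> 'b \<Rightarrow> 'b"
  assumes countable_B: "countable B"
    and act_in: "mono f \<Longrightarrow> b \<in> B \<Longrightarrow> h f b \<in> B"
    and act_comp: "mono f \<Longrightarrow> mono g \<Longrightarrow> b \<in> B \<Longrightarrow> h (f \<circ> g) b = h f (h g b)"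
    and act_id: "b \<in> B \<Longrightarrow> h id b = b"
    and act_closed: "(\<And>F. finite F \<Longrightarrow> F \<subseteq> B \<Longrightarrow> \<exists>f. mono f \<and> (\<forall>b\<in>F. h f b = t b)) \<Longrightarrow>
      \<exists>f. mono f \<and> (\<forall>b\<in>B. h f b = t b)"
    and act_reconstructs: "\<exists>F. finite F \<and> F \<subseteq> B \<and>
      (\<forall>f g. mono f \<longrightarrow> mono g \<longrightarrow> (\<forall>b\<in>F. h f b = h g b) \<longrightarrow> f q = g q)"
begin

text \<open>
  If the values \<open>h (w n) b\<close> settle for every \<open>b\<close>, their limit is \<open>h f'\<close> for some \<open>f'\<close> by
  closedness; by reconstruction, \<open>f'\<close> is also the pointwise limit of the \<open>w n\<close>, so \<open>f' = f\<close>.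
  Hence convergence of the action suffices for continuity along a sequence: its limit cannot be wrong.
\<close>

lemma act_limit:
  assumes w: "\<And>n. mono (w n)" and f: "mono f"
    and lim: "\<And>q. \<forall>\<^sub>F n in sequentially. w n q = f q"
    and conv: "\<And>b. b \<in> B \<Longrightarrow> \<exists>c. \<forall>\<^sub>F n in sequentially. h (w n) b = c"
    and b: "b \<in> B"
  shows "\<forall>\<^sub>F n in sequentially. h (w n) b = h f b"
proof -
  obtain t where t: "\<And>b. b \<in> B \<Longrightarrow> \<forall>\<^sub>F n in sequentially. h (w n) b = t b"
    using conv by metis
  have "\<exists>f. mono f \<and> (\<forall>b\<in>F. h f b = t b)" if F: "finite F" "F \<subseteq> B" for F
  proof -
    have "\<forall>\<^sub>F n in sequentially. \<forall>b\<in>F. h (w n) b = t b"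
      using F t by (auto intro!: eventually_ball_finite)
    then obtain n where "\<forall>b\<in>F. h (w n) b = t b"
      by (auto simp: eventually_sequentially)
    then show ?thesis using w by blast
  qed
  then obtain f' where f': "mono f'" "\<forall>b\<in>B. h f' b = t b"
    using act_closed[of t] by blast
  have "f' q = f q" for q
  proof -
    obtain F where F: "finite F" "F \<subseteq> B"
        "\<And>f g. mono f \<Longrightarrow> mono g \<Longrightarrow> \<forall>b\<in>F. h f b = h g b \<Longrightarrow> f q = g q"
      using act_reconstructs[of q] by metis
    have "\<forall>\<^sub>F n in sequentially. \<forall>b\<in>F. h (w n) b = t b"
      using F t by (auto intro!: eventually_ball_finite)
    then have "\<forall>\<^sub>F n in sequentially. f' q = f q"
      using lim[of q]
    proof eventually_elim
      case (elim n)
      then have "\<forall>b\<in>F. h (w n) b = h f' b" using f'(2) F(2) by auto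
      then show ?case using F(3)[OF w f'(1)] elim by metis
    qed
    then show ?thesis by simp
  qed
  then have "f' = f" by auto
  then show ?thesis using t[OF b] f'(2) b by simp
qed

text \<open>
  The stabiliser of a finite set \<open>A\<close> has countable index in the automorphism group, since its cosets
  correspond to maps from \<open>A\<close> to the countable set \<open>B\<close>. By Baire category some coset is
  dense near one of its own elements \<open>v0\<close>. Translating by the inverse of \<open>v0\<close>
  makes the stabiliser itself dense near the identity.
\<close>

lemma stabiliser_dense:
  assumes A: "finite A" "A \<subseteq> B"
  shows "\<exists>F. finite F \<and> (\<forall>g\<in>automorphisms_rat. (\<forall>x\<in>F. g x = x) \<longrightarrow>
    (\<forall>F'. finite F' \<longrightarrow>
      (\<exists>v\<in>automorphisms_rat. (\<forall>b\<in>A. h v b = b) \<and> (\<forall>x\<in>F'. v x = g x))))"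
proof -
  define C where "C c = {g \<in> automorphisms_rat. \<forall>b\<in>A. h g b = c b}" for c
  have "automorphisms_rat \<subseteq> \<Union> (C ` (A \<rightarrow>\<^sub>E B))"
  proof
    fix g assume g: "g \<in> automorphisms_rat"
    then have "restrict (h g) A \<in> A \<rightarrow>\<^sub>E B" using A(2) act_in automorphisms_rat_mono by auto
    moreover have "g \<in> C (restrict (h g) A)" using g by (simp add: C_def)
    ultimately show "g \<in> \<Union> (C ` (A \<rightarrow>\<^sub>E B))" by blast
  qed
  then have cover: "\<Union> (C ` (A \<rightarrow>\<^sub>E B)) = automorphisms_rat" by (auto simp: C_def)
  have "countable (C ` (A \<rightarrow>\<^sub>E B))"
    using A(1) countable_B by (intro countable_image countable_PiE)
  from somewhere_dense_cover_member[OF this cover]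
  obtain c g0 F where g0: "g0 \<in> automorphisms_rat" and F: "finite F"
    and dense: "\<And>g F'. g \<in> automorphisms_rat \<Longrightarrow> \<forall>x\<in>F. g x = g0 x \<Longrightarrow> finite F' \<Longrightarrow>
      \<exists>v\<in>C c. \<forall>x\<in>F'. v x = g x"
    by (auto 0 0) metis
  obtain v0 where v0: "v0 \<in> C c" "\<forall>x\<in>F. v0 x = g0 x" using dense[OF g0 _ F] by blast
  then have v0A: "v0 \<in> automorphisms_rat" by (simp add: C_def)
  obtain u where u: "u \<in> automorphisms_rat" "u \<circ> v0 = id" using automorphisms_rat_inverse[OF v0A] by blast
  have "\<exists>v\<in>automorphisms_rat. (\<forall>b\<in>A. h v b = b) \<and> (\<forall>x\<in>F'. v x = g x)"
    if g: "g \<in> automorphisms_rat" "\<forall>x\<in>F. g x = x" and F': "finite F'" for g F'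
  proof -
    have "v0 \<circ> g \<in> automorphisms_rat" "\<forall>x\<in>F. (v0 \<circ> g) x = g0 x"
      using automorphisms_rat_comp[OF v0A g(1)] v0(2) g(2) by auto
    then obtain v where v: "v \<in> C c" "\<forall>x\<in>F'. v x = (v0 \<circ> g) x" using dense F' by blast
    have vA: "v \<in> automorphisms_rat" using v(1) by (simp add: C_def)
    have "h (u \<circ> v) b = b" if b: "b \<in> A" for b
    proof -
      have bB: "b \<in> B" using A(2) b by blast
      have "h (u \<circ> v) b = h u (h v b)"
        using act_comp automorphisms_rat_mono u(1) vA bB by blast
      also have "h v b = h v0 b" using b v(1) v0(1) by (simp add: C_def)
      also have "h u (h v0 b) = h (u \<circ> v0) b"
        using act_comp automorphisms_rat_mono u(1) v0A bB by metis
      also have "\<dots> = b" using u(2) act_id bB by simp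
      finally show ?thesis .
    qed
    moreover have "(u \<circ> v) x = g x" if "x \<in> F'" for x
      using v(2) that u(2) by (metis comp_apply id_apply)
    ultimately show ?thesis using automorphisms_rat_comp[OF u(1) vA] by blast
  qed
  then show ?thesis using F by (intro exI[of _ F]) simp
qed

text \<open>
  Density near the identity is upgraded to openness as in the open mapping theorem for complete
  groups. Given \<open>g\<close> near the identity, factor it as \<open>w \<circ> r\<close>, where \<open>w\<close> is a product of elements of
  smaller and smaller stabilisers, each chosen by density to approximate the current remainder
  \<open>r\<close>; the new remainder is then the identity on a larger finite set. The products converge to \<open>g\<close>
  pointwise. Their actions converge too, as later factors fix more and more of \<open>B\<close>, so by
  \<open>act_limit\<close> the action of \<open>g\<close> is the limit of theirs. They all fix \<open>b\<close>, hence so does \<open>g\<close>.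
\<close>

lemma stabiliser_open:
  assumes b: "b \<in> B"
  shows "\<exists>F. finite F \<and> (\<forall>g\<in>automorphisms_rat. (\<forall>x\<in>F. g x = x) \<longrightarrow> h g b = b)"
proof -
  define A where "A n = insert b (from_nat_into B ` {..<n})" for n :: nat
  have A: "finite (A n)" "A n \<subseteq> B" for n
    using b from_nat_into[of B] by (auto simp: A_def)
  have A_mono: "a \<in> A n" if "a \<in> A m" "m \<le> n" for a m n using that by (auto simp: A_def)
  have A_cover: "\<exists>n. a \<in> A n" if a: "a \<in> B" for a
  proof -
    obtain i where "a = from_nat_into B i"
      using from_nat_into_surj[OF countable_B a] by blast
    then show ?thesis by (intro exI[of _ "Suc i"]) (auto simp: A_def)
  qed
  have "\<exists>F. \<forall>n. finite (F n) \<and> (\<forall>g\<in>automorphisms_rat. (\<forall>x\<in>F n. g x = x) \<longrightarrow>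
      (\<forall>F'. finite F' \<longrightarrow>
        (\<exists>v\<in>automorphisms_rat. (\<forall>a\<in>A n. h v a = a) \<and> (\<forall>x\<in>F'. v x = g x))))"
    by (intro choice allI stabiliser_dense A)
  then obtain F where "\<forall>n. finite (F n) \<and> (\<forall>g\<in>automorphisms_rat. (\<forall>x\<in>F n. g x = x) \<longrightarrow>
      (\<forall>F'. finite F' \<longrightarrow>
        (\<exists>v\<in>automorphisms_rat. (\<forall>a\<in>A n. h v a = a) \<and> (\<forall>x\<in>F'. v x = g x))))"
    by (rule exE)
  then have F: "\<And>n. finite (F n)"
    and approx: "\<And>n r F'. r \<in> automorphisms_rat \<Longrightarrow> \<forall>x\<in>F n. r x = x \<Longrightarrow> finite F' \<Longrightarrow>
      \<exists>v\<in>automorphisms_rat. (\<forall>a\<in>A n. h v a = a) \<and> (\<forall>x\<in>F'. v x = r x)"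
    by simp_all
  have "h g b = b" if g: "g \<in> automorphisms_rat" "\<forall>x\<in>F 0. g x = x" for g
  proof -
    (* A state z is the pair of the product w so far and the remainder r; Q says that each step
       changes w only by an element fixing A n, and leaves a remainder fixing n rationals. *)
    define P where "P n z \<longleftrightarrow> fst z \<in> automorphisms_rat \<and> snd z \<in> automorphisms_rat \<and>
      fst z \<circ> snd z = g \<and> (\<forall>x\<in>F n. snd z x = x) \<and> h (fst z) b = b" for n :: nat and z
    define Q where "Q n z z' \<longleftrightarrow> (\<forall>i<n. snd z' (from_nat i) = from_nat i) \<and>
      (\<forall>a\<in>A n. h (fst z') a = h (fst z) a)" for n :: nat and z z' :: "(rat \<Rightarrow> rat) \<times> (rat \<Rightarrow> rat)"
    have "\<exists>Z. \<forall>n. P n (Z n) \<and> Q n (Z n) (Z (Suc n))"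
    proof (rule dependent_nat_choice)
      show "\<exists>z. P 0 z"
        using g automorphisms_rat_id act_id[OF b] by (intro exI[of _ "(id, g)"]) (simp add: P_def)
      fix z n assume "P n z"
      then have z: "fst z \<in> automorphisms_rat" "snd z \<in> automorphisms_rat"
          "fst z \<circ> snd z = g" "\<forall>x\<in>F n. snd z x = x" "h (fst z) b = b"
        by (auto simp: P_def)
      obtain v where v: "v \<in> automorphisms_rat" "\<forall>a\<in>A n. h v a = a"
          "\<forall>x\<in>F (Suc n) \<union> from_nat ` {..<n}. v x = snd z x"
        using approx[OF z(2,4), of "F (Suc n) \<union> from_nat ` {..<n}"] F by blast
      obtain u where u: "u \<in> automorphisms_rat" "u \<circ> v = id" "v \<circ> u = id"
        using automorphisms_rat_inverse[OF v(1)] by blast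
      have fixed: "(u \<circ> snd z) x = x" if "x \<in> F (Suc n) \<union> from_nat ` {..<n}" for x
        using v(3) u(2) that by (metis comp_apply id_apply)
      have hv: "h (fst z \<circ> v) a = h (fst z) a" if "a \<in> A n" for a
        using act_comp[OF automorphisms_rat_mono[OF z(1)] automorphisms_rat_mono[OF v(1)], of a]
          v(2) that A(2) by auto
      have "(fst z \<circ> v) \<circ> (u \<circ> snd z) = fst z \<circ> (v \<circ> u) \<circ> snd z" by (simp only: o_assoc)
      also have "\<dots> = g" using u(3) z(3) by simp
      finally have "(fst z \<circ> v) \<circ> (u \<circ> snd z) = g" .
      moreover have "h (fst z \<circ> v) b = b" using hv[of b] z(5) by (simp add: A_def)
      ultimately have "P (Suc n) (fst z \<circ> v, u \<circ> snd z)"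
        using automorphisms_rat_comp z(1,2) v(1) u(1) fixed by (simp add: P_def del: comp_apply)
      moreover have "Q n z (fst z \<circ> v, u \<circ> snd z)"
        using fixed hv by (simp add: Q_def del: comp_apply)
      ultimately show "\<exists>z'. P (Suc n) z' \<and> Q n z z'" by blast
    qed
    then obtain Z where Z: "\<And>n. P n (Z n)" "\<And>n. Q n (Z n) (Z (Suc n))" by blast
    define w where "w n = fst (Z n)" for n
    have w: "w n \<in> automorphisms_rat" and wb: "h (w n) b = b" for n
      using Z(1)[of n] by (auto simp: P_def w_def)
    have "\<forall>\<^sub>F n in sequentially. w n q = g q" for q
    proof -
      have "w n q = g q" if n: "n \<ge> Suc (Suc (to_nat q))" for n
      proof -
        obtain m where m: "n = Suc m" "to_nat q < m" using n by (cases n) auto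
        then have "snd (Z n) q = q" using Z(2)[of m] by (auto simp: Q_def)
        moreover have "w n (snd (Z n) q) = g q" using Z(1)[of n] by (auto simp: P_def w_def)
        ultimately show ?thesis by simp
      qed
      then show ?thesis by (auto simp: eventually_sequentially)
    qed
    moreover have "\<exists>c. \<forall>\<^sub>F n in sequentially. h (w n) a = c" if a: "a \<in> B" for a
    proof -
      obtain m where m: "a \<in> A m" using A_cover[OF a] by blast
      have "h (w n) a = h (w m) a" if "n \<ge> m" for n
        using that
      proof (induction n rule: dec_induct)
        case (step n)
        then show ?case using Z(2)[of n] A_mono[OF m, of n] by (simp add: Q_def w_def)
      qed simp
      then show ?thesis by (auto simp: eventually_sequentially)
    qed
    ultimately have "\<forall>\<^sub>F n in sequentially. h (w n) b = h g b"
      using act_limit[of w g b] w g(1) b automorphisms_rat_mono by blast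
    then show ?thesis by (simp add: wb)
  qed
  then show ?thesis using F[of 0] by (intro exI[of _ "F 0"]) simp
qed

lemma act_automorphisms_local:
  assumes b: "b \<in> B"
  shows "\<exists>F. finite F \<and> (\<forall>v\<in>automorphisms_rat. \<forall>w\<in>automorphisms_rat.
    (\<forall>x\<in>F. v x = w x) \<longrightarrow> h v b = h w b)"
proof -
  obtain F where F: "finite F" "\<And>g. g \<in> automorphisms_rat \<Longrightarrow> \<forall>x\<in>F. g x = x \<Longrightarrow> h g b = b"
    using stabiliser_open[OF b] by metis
  have "h v b = h w b"
    if v: "v \<in> automorphisms_rat" and w: "w \<in> automorphisms_rat" and eq: "\<forall>x\<in>F. v x = w x" for v w
  proof -
    obtain u where u: "u \<in> automorphisms_rat" "u \<circ> w = id" "w \<circ> u = id"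
      using automorphisms_rat_inverse[OF w] by blast
    have uv: "u \<circ> v \<in> automorphisms_rat" using automorphisms_rat_comp u(1) v by blast
    have "\<forall>x\<in>F. (u \<circ> v) x = x" using eq u(2) by (metis comp_apply id_apply)
    then have "h (u \<circ> v) b = b" using F(2) uv by blast
    moreover have "w \<circ> (u \<circ> v) = v" using u(3) by (metis o_assoc id_comp)
    ultimately show ?thesis
      using act_comp[OF automorphisms_rat_mono[OF w] automorphisms_rat_mono[OF uv] b] by simp
  qed
  then show ?thesis using F(1) by (intro exI[of _ F]) blast
qed

text \<open>
  Write \<open>f\<close> as \<open>s\<close> after an embedding, and the embedding as a limit of automorphisms \<open>v n\<close>. The
  actions of \<open>v n\<close> settle at every point because they depend only on finitely many values, so those
  of \<open>s \<circ> v n\<close> settle too, and by \<open>act_limit\<close> they settle at the action of \<open>f\<close>. Therefore \<open>h f b\<close> is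
  \<open>h s (h w b)\<close> for any one automorphism \<open>w\<close> that agrees with the embedding on \<open>F b\<close>;
  such a \<open>w\<close> depends only on the values of \<open>f\<close> on \<open>F b\<close>.
\<close>

theorem act_local:
  assumes b: "b \<in> B"
  shows "\<exists>F. finite F \<and> (\<forall>f g. mono f \<longrightarrow> mono g \<longrightarrow> (\<forall>x\<in>F. f x = g x) \<longrightarrow> h f b = h g b)"
proof -
  obtain s :: "rat \<Rightarrow> rat" and k :: "rat \<Rightarrow> rat \<Rightarrow> rat" where s: "mono s" and "\<forall>y x. s (k y x) = y"
      and "\<forall>f. mono f \<longrightarrow> strict_mono (\<lambda>x. k (f x) x)"
    using exists_universal_mono_map by (elim exE conjE)
  then have sk: "\<And>y x. s (k y x) = y" and k: "\<And>f. mono f \<Longrightarrow> strict_mono (\<lambda>x. k (f x) x)"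
    by simp_all
  have "\<exists>F. \<forall>b\<in>B. finite (F b) \<and> (\<forall>v\<in>automorphisms_rat. \<forall>w\<in>automorphisms_rat.
      (\<forall>x\<in>F b. v x = w x) \<longrightarrow> h v b = h w b)"
    by (intro bchoice ballI act_automorphisms_local)
  then obtain F where "\<forall>b\<in>B. finite (F b) \<and> (\<forall>v\<in>automorphisms_rat. \<forall>w\<in>automorphisms_rat.
      (\<forall>x\<in>F b. v x = w x) \<longrightarrow> h v b = h w b)"
    by (rule exE)
  then have F: "\<And>b. b \<in> B \<Longrightarrow> finite (F b)"
    and F_eq: "\<And>b v w. b \<in> B \<Longrightarrow> v \<in> automorphisms_rat \<Longrightarrow> w \<in> automorphisms_rat \<Longrightarrow>
      \<forall>x\<in>F b. v x = w x \<Longrightarrow> h v b = h w b"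
    by blast+
  have h_eq: "h f b = h s (h w b)"
    if f: "mono f" and w: "w \<in> automorphisms_rat" "\<forall>x\<in>F b. w x = k (f x) x" for f w
  proof -
    have "\<forall>n. \<exists>v. v \<in> automorphisms_rat \<and> (\<forall>x\<in>from_nat ` {..<n}. v x = k (f x) x)"
      using exists_automorphism_agreeing[OF k[OF f] finite_imageI[OF finite_lessThan]] by blast
    from choice[OF this] obtain v where v: "\<And>n. v n \<in> automorphisms_rat"
      and v_eq: "\<And>n x. x \<in> from_nat ` {..<n} \<Longrightarrow> v n x = k (f x) x" by blast
    have v_lim: "\<forall>\<^sub>F n in sequentially. v n x = k (f x) x" for x
      unfolding eventually_sequentially
      by (intro exI[of _ "Suc (to_nat x)"] allI impI v_eq image_eqI[of _ _ "to_nat x"]) auto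
    have v_conv: "\<forall>\<^sub>F n in sequentially. h (s \<circ> v n) a = h s (h w a)"
      if a: "a \<in> B" and w: "w \<in> automorphisms_rat" "\<forall>x\<in>F a. w x = k (f x) x" for a w
    proof -
      have "\<forall>\<^sub>F n in sequentially. \<forall>x\<in>F a. v n x = k (f x) x"
        using F[OF a] v_lim by (auto intro!: eventually_ball_finite)
      then show ?thesis
      proof eventually_elim
        case (elim n)
        then have "h (v n) a = h w a" using F_eq[OF a v w(1)] w(2) by simp
        then show ?case using act_comp[OF s automorphisms_rat_mono[OF v] a] by simp
      qed
    qed
    have "\<exists>c. \<forall>\<^sub>F n in sequentially. h (s \<circ> v n) a = c" if a: "a \<in> B" for a
    proof -
      obtain w where "w \<in> automorphisms_rat" "\<forall>x\<in>F a. w x = k (f x) x"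
        using exists_automorphism_agreeing[OF k[OF f] F[OF a]] by (elim bexE)
      then show ?thesis using v_conv[OF a] by blast
    qed
    moreover have "\<forall>\<^sub>F n in sequentially. (s \<circ> v n) q = f q" for q
      using v_lim[of q] by eventually_elim (simp add: sk)
    moreover have "mono (s \<circ> v n)" for n
      using s automorphisms_rat_mono[OF v] by (simp add: mono_def)
    ultimately have "\<forall>\<^sub>F n in sequentially. h (s \<circ> v n) b = h f b"
      using act_limit[of "\<lambda>n. s \<circ> v n" f b] f b by blast
    with v_conv[OF b w] have "\<forall>\<^sub>F n :: nat in sequentially. h f b = h s (h w b)"
      by eventually_elim simp
    then show ?thesis by simp
  qed
  have "h f b = h g b" if f: "mono f" and g: "mono g" and eq: "\<forall>x\<in>F b. f x = g x" for f g
  proof -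
    obtain w where w: "w \<in> automorphisms_rat" "\<forall>x\<in>F b. w x = k (f x) x"
      using exists_automorphism_agreeing[OF k[OF f] F[OF b]] by (elim bexE)
    then show ?thesis using h_eq[OF f w] h_eq[OF g w(1)] eq by simp
  qed
  then show ?thesis using F[OF b] by (intro exI[of _ "F b"]) blast
qed

end

section \<open>Endomorphism monoids with finitely many weak orbits\<close>

lemma carrier_End: "carrier (End \<B>) = endomorphisms \<B>"
  by (simp add: End_def)

lemma endomorphisms_PiE: "endomorphisms \<B> \<subseteq> universe \<B> \<rightarrow>\<^sub>E universe \<B>"
  by (auto simp: endomorphisms_def)

lemma mult_End: "f \<otimes>\<^bsub>End \<B>\<^esub> g = compose (universe \<B>) f g"
  by (simp add: End_def full_transformation_monoid_def)

lemma mult_End_rat_le: "f \<otimes>\<^bsub>End rat_le\<^esub> g = f \<circ> g"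
  by (simp add: mult_End rat_le_def compose_def fun_eq_iff)

lemma iso_imp_bij_betw:
  "h \<in> iso (End rat_le) (End \<B>) \<Longrightarrow> bij_betw h {f. mono f} (endomorphisms \<B>)"
  unfolding iso_def mem_Collect_eq carrier_End_rat_le carrier_End[of \<B>] by (rule conjunct2)

text \<open>
  A relation is finitary, so whether a map preserves one of its tuples is decided by finitely many
  values. Endomorphism monoids are therefore closed under pointwise limits.
\<close>

lemma endomorphisms_closed:
  assumes "relational_structure \<B>"
    and approx: "\<And>F. finite F \<Longrightarrow> F \<subseteq> universe \<B> \<Longrightarrow> \<exists>m\<in>endomorphisms \<B>. \<forall>b\<in>F. m b = t b"
  shows "restrict t (universe \<B>) \<in> endomorphisms \<B>"
  unfolding endomorphisms_def
proof (intro CollectI conjI ballI)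
  have "t b \<in> universe \<B>" if b: "b \<in> universe \<B>" for b
  proof -
    obtain m where "m \<in> endomorphisms \<B>" "m b = t b" using approx[of "{b}"] b by auto
    then show ?thesis using endomorphisms_PiE b by (metis PiE_mem subsetD)
  qed
  then show "restrict t (universe \<B>) \<in> universe \<B> \<rightarrow>\<^sub>E universe \<B>" by simp
  fix s xs assume s: "s \<in> symbols \<B>" and xs: "xs \<in> interp \<B> s"
  have xs_B: "set xs \<subseteq> universe \<B>"
    using assms(1) s xs by (auto simp: relational_structure_def)
  obtain m where m: "m \<in> endomorphisms \<B>" "\<forall>b\<in>set xs. m b = t b"
    using approx[OF finite_set xs_B] by blast
  have "map (restrict t (universe \<B>)) xs = map m xs" using m(2) xs_B by auto
  then show "map (restrict t (universe \<B>)) xs \<in> interp \<B> s"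
    using m(1) s xs by (auto simp: endomorphisms_def simp del: map_eq_conv)
qed

text \<open>
  Used for a left zero \<open>e\<close> of a transformation monoid: \<open>e \<circ> m = e\<close> for all \<open>m\<close> makes \<open>e\<close> constant on
  each weak orbit.
\<close>

lemma weak_orbit_equiv_invariant:
  assumes "(a, b) \<in> weak_orbit_equiv M B"
    and inv: "\<And>m b. m \<in> M \<Longrightarrow> b \<in> B \<Longrightarrow> m b \<in> B \<Longrightarrow> e (m b) = e b"
  shows "e a = e b"
proof -
  let ?E = "{(x, y). x \<in> B \<and> y \<in> B \<and> e x = e y}"
  have "equiv B ?E" by (auto simp: equiv_def refl_on_def sym_def trans_def)
  moreover have "weak_preorder M B \<subseteq> ?E" using inv by (auto simp: weak_preorder_def)
  ultimately have "weak_orbit_equiv M B \<subseteq> ?E" unfolding weak_orbit_equiv_def by blast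
  then show ?thesis using assms(1) by blast
qed

lemma weak_orbit_representatives:
  assumes "finite (weak_orbits M B)"
  shows "\<exists>R. finite R \<and> R \<subseteq> B \<and> (\<forall>b\<in>B. \<exists>r\<in>R. (b, r) \<in> weak_orbit_equiv M B)"
proof -
  let ?E = "weak_orbit_equiv M B"
  note eq = equiv_weak_orbit_equiv[of B M]
  define R where "R = (\<lambda>X. SOME x. x \<in> X) ` weak_orbits M B"
  have some: "(SOME x. x \<in> X) \<in> X" if "X \<in> weak_orbits M B" for X
    using in_quotient_imp_non_empty[OF eq] that by (simp add: weak_orbits_def some_in_eq)
  have "R \<subseteq> B"
    using some in_quotient_imp_subset[OF eq] by (auto simp: R_def weak_orbits_def)
  moreover have "\<exists>r\<in>R. (b, r) \<in> ?E" if "b \<in> B" for b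
  proof -
    have "?E `` {b} \<in> weak_orbits M B" using that by (simp add: weak_orbits_def quotientI)
    from this some[OF this] show ?thesis
      unfolding R_def by (intro bexI[OF _ imageI]) simp_all
  qed
  ultimately show ?thesis using assms by (intro exI[of _ R]) (simp add: R_def)
qed

text \<open>
  The finiteness of the set of weak orbits enters through the images \<open>e p\<close> of the constant maps.
  Constant maps are left zeros, so each \<open>e p\<close> is constant on weak orbits and is
  determined by its values on a finite set \<open>R\<close> of representatives. As \<open>h f\<close> composed with \<open>e q\<close> is
  \<open>e (f q)\<close>, the values of \<open>h f\<close> on the finite set \<open>e q ` R\<close> determine \<open>e (f q)\<close>, and so \<open>f q\<close>
  by injectivity.
\<close>

lemma iso_rational_endomorphism_action:
  fixes \<B> :: "('i, 'b) rel_struct"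
  assumes struct: "relational_structure \<B>"
    and countable: "countable (universe \<B>)"
    and orbits: "finite (weak_orbits (carrier (End \<B>)) (universe \<B>))"
    and iso: "h \<in> iso (End rat_le) (End \<B>)"
  shows "rational_endomorphism_action (universe \<B>) h"
proof -
  let ?B = "universe \<B>"
  have bij: "bij_betw h {f. mono f} (endomorphisms \<B>)"
    using iso_imp_bij_betw[OF iso] .
  have h_in: "h f \<in> endomorphisms \<B>" if "mono f" for f
    using bij_betw_apply[OF bij, of f] that by simp
  have h_surj: "\<exists>f. mono f \<and> h f = m" if "m \<in> endomorphisms \<B>" for m
    using that unfolding bij_betw_imp_surj_on[OF bij, symmetric] by (elim imageE) auto
  have h_in_B: "h f b \<in> ?B" if "mono f" "b \<in> ?B" for f b
    using PiE_mem[OF subsetD[OF endomorphisms_PiE h_in[OF that(1)]] that(2)] .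
  have h_compose: "h (f \<circ> g) = compose ?B (h f) (h g)" if "mono f" "mono g" for f g
    using iso that by (auto simp: iso_def hom_def carrier_End_rat_le mult_End[of \<B>] mult_End_rat_le)
  have h_comp: "h (f \<circ> g) b = h f (h g b)" if "mono f" "mono g" "b \<in> ?B" for f g b
    using h_compose[OF that(1,2)] that(3) by (simp add: compose_def)
  have mono_id: "mono (id :: rat \<Rightarrow> rat)" by (simp add: mono_def)
  have mono_const: "mono (\<lambda>_ :: rat. q)" for q :: rat by (simp add: mono_def)
  have h_id: "h id b = b" if b: "b \<in> ?B" for b
  proof -
    have "restrict (\<lambda>x. x) ?B \<in> endomorphisms \<B>"
      using map_preserves_universe(2)[OF struct] by (auto simp: endomorphisms_def)
    then obtain f where f: "mono f" "h f = restrict (\<lambda>x. x) ?B" using h_surj by blast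
    then have "h id (h f b) = h f b" using h_comp[OF mono_id f(1) b] by simp
    then show ?thesis using f(2) b by simp
  qed
  have h_closed: "\<exists>f. mono f \<and> (\<forall>b\<in>?B. h f b = t b)"
    if t: "\<And>F. finite F \<Longrightarrow> F \<subseteq> ?B \<Longrightarrow> \<exists>f. mono f \<and> (\<forall>b\<in>F. h f b = t b)" for t
  proof -
    have "restrict t ?B \<in> endomorphisms \<B>"
      by (rule endomorphisms_closed[OF struct]) (metis t h_in)
    then obtain f where "mono f" "h f = restrict t ?B" using h_surj by blast
    then show ?thesis by auto
  qed
  have h_reconstructs: "\<exists>F. finite F \<and> F \<subseteq> ?B \<and>
      (\<forall>f g. mono f \<longrightarrow> mono g \<longrightarrow> (\<forall>b\<in>F. h f b = h g b) \<longrightarrow> f q = g q)" for q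
  proof -
    define e where "e p = h (\<lambda>_. p)" for p
    have e_in: "e p \<in> endomorphisms \<B>" for p using h_in[OF mono_const] by (simp add: e_def)
    have e_left: "h f (e p b) = e (f p) b" if "mono f" "b \<in> ?B" for f p b
      using h_comp[OF that(1) mono_const that(2)] by (simp add: e_def comp_def)
    have e_right: "e p (h f b) = e p b" if "mono f" "b \<in> ?B" for f p b
      using h_comp[OF mono_const that] by (simp add: e_def comp_def)
    obtain R where R: "finite R" "R \<subseteq> ?B"
      and R_repr: "\<And>b. b \<in> ?B \<Longrightarrow> \<exists>r\<in>R. (b, r) \<in> weak_orbit_equiv (endomorphisms \<B>) ?B"
      using weak_orbit_representatives[OF orbits] unfolding carrier_End by blast
    have e_orbit: "e p a = e p b" if ab: "(a, b) \<in> weak_orbit_equiv (endomorphisms \<B>) ?B" for p a b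
    proof (rule weak_orbit_equiv_invariant[OF ab])
      fix m b assume m: "m \<in> endomorphisms \<B>" and b: "b \<in> ?B"
      obtain f where "mono f" "h f = m" using h_surj m by blast
      then show "e p (m b) = e p b" using e_right b by blast
    qed
    have "f q = g q" if f: "mono f" and g: "mono g" and eq: "\<forall>b\<in>e q ` R. h f b = h g b" for f g
    proof -
      have "e (f q) b = e (g q) b" if b: "b \<in> ?B" for b
      proof -
        obtain r where r: "r \<in> R" "(b, r) \<in> weak_orbit_equiv (endomorphisms \<B>) ?B"
          using R_repr[OF b] by blast
        have rB: "r \<in> ?B" using r(1) R(2) by blast
        have "e (f q) r = h f (e q r)" using e_left[OF f rB] by simp
        also have "\<dots> = h g (e q r)" using eq r(1) by blast
        also have "\<dots> = e (g q) r" using e_left[OF g rB] by simp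
        finally show ?thesis using e_orbit[OF r(2)] by simp
      qed
      then have "e (f q) = e (g q)"
        by (rule PiE_ext[OF subsetD[OF endomorphisms_PiE e_in] subsetD[OF endomorphisms_PiE e_in]])
      then have "(\<lambda>_ :: rat. f q) = (\<lambda>_. g q)"
        unfolding e_def by (rule inj_onD[OF bij_betw_imp_inj_on[OF bij]]) (simp_all add: mono_const)
      then show ?thesis by (rule fun_cong)
    qed
    moreover have "e q ` R \<subseteq> ?B"
      using R(2) h_in_B[OF mono_const] by (auto simp: e_def)
    ultimately show ?thesis using R(1) by (intro exI[of _ "e q ` R"]) blast
  qed
  show ?thesis
    using rational_endomorphism_action.intro[OF countable h_in_B h_comp h_id h_closed h_reconstructs] .
qed

theorem theorem4p11:
  fixes \<B> :: "('i, 'b) rel_struct"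
    and h :: "(rat \<Rightarrow> rat) \<Rightarrow> ('b \<Rightarrow> 'b)"
  assumes "relational_structure \<B>"
    and "countable (universe \<B>)"
    and "finite (weak_orbits (carrier (End \<B>)) (universe \<B>))"
    and "h \<in> iso (End rat_le) (End \<B>)"
  shows "homeomorphic_map (End_topology rat_le) (End_topology \<B>) h"
proof -
  interpret rational_endomorphism_action "universe \<B>" h
    using iso_rational_endomorphism_action[OF assms] .
  let ?M = "{f :: rat \<Rightarrow> rat. mono f}" and ?N = "endomorphisms \<B>"
  let ?h' = "inv_into ?M h"
  have X: "End_topology rat_le = subtopology (pointwise_topology UNIV) ?M"
    unfolding End_topology_def carrier_End_rat_le by (simp add: rat_le_def)
  have Y: "End_topology \<B> = subtopology (pointwise_topology (universe \<B>)) ?N"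
    by (simp add: End_topology_def carrier_End)
  have M: "?M \<subseteq> UNIV \<rightarrow>\<^sub>E UNIV" by simp
  have bij: "bij_betw h ?M ?N"
    using iso_imp_bij_betw[OF assms(4)] .
  have bij': "bij_betw ?h' ?N ?M" using bij_betw_inv_into[OF bij] .
  have h'_h: "?h' (h f) = f" if "f \<in> ?M" for f using bij_betw_inv_into_left[OF bij that] .
  have h_h': "h (?h' m) = m" if "m \<in> ?N" for m using bij_betw_inv_into_right[OF bij that] .
  have "continuous_map (End_topology rat_le) (End_topology \<B>) h"
    unfolding X Y
  proof (rule continuous_map_pointwise[OF M endomorphisms_PiE])
    show "h ` ?M \<subseteq> ?N" using bij by (simp add: bij_betw_def)
    fix b f assume b: "b \<in> universe \<B>" and f: "f \<in> ?M"
    obtain F where "finite F"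
        "\<forall>f g. mono f \<longrightarrow> mono g \<longrightarrow> (\<forall>x\<in>F. f x = g x) \<longrightarrow> h f b = h g b"
      using act_local[OF b] by (elim exE conjE)
    then show "\<exists>F. finite F \<and> F \<subseteq> UNIV \<and> (\<forall>g\<in>?M. (\<forall>x\<in>F. g x = f x) \<longrightarrow> h g b = h f b)"
      using f by (intro exI[of _ F]) blast
  qed
  moreover have "continuous_map (End_topology \<B>) (End_topology rat_le) ?h'"
    unfolding X Y
  proof (rule continuous_map_pointwise[OF endomorphisms_PiE M])
    show "?h' ` ?N \<subseteq> ?M" using bij' by (simp add: bij_betw_def)
    fix q :: rat and m assume m: "m \<in> ?N"
    obtain F where F: "finite F" "F \<subseteq> universe \<B>"
        "\<forall>f g. mono f \<longrightarrow> mono g \<longrightarrow> (\<forall>b\<in>F. h f b = h g b) \<longrightarrow> f q = g q"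
      using act_reconstructs[of q] by (elim exE conjE)
    have "?h' n q = ?h' m q" if n: "n \<in> ?N" "\<forall>b\<in>F. n b = m b" for n
    proof -
      have "mono (?h' n)" "mono (?h' m)" using bij_betwE[OF bij'] n(1) m by blast+
      moreover have "\<forall>b\<in>F. h (?h' n) b = h (?h' m) b" using h_h'[OF n(1)] h_h'[OF m] n(2) by simp
      ultimately show ?thesis using F(3) by blast
    qed
    then show "\<exists>F. finite F \<and> F \<subseteq> universe \<B> \<and>
        (\<forall>n\<in>?N. (\<forall>x\<in>F. n x = m x) \<longrightarrow> ?h' n q = ?h' m q)"
      using F(1,2) by (intro exI[of _ F]) blast
  qed
  moreover have "topspace (End_topology rat_le) = ?M" "topspace (End_topology \<B>) = ?N"
    by (simp_all only: topspace_End_topology carrier_End_rat_le carrier_End[of \<B>])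
  ultimately have "homeomorphic_maps (End_topology rat_le) (End_topology \<B>) h ?h'"
    using h'_h h_h' by (simp add: homeomorphic_maps_def)
  then show ?thesis unfolding homeomorphic_map_maps by (intro exI)
qed

end
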